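(* Let $X,Y$ be LCTV spaces, $\phi\colon X\times Y\to\overline{\mathbb R}$ a function, $F\colon X\rightrightarrows Y$ a set-valued mapping, and let $\mu(x):=\inf\{\phi(x,y)\mid y\in F(x)\}$ for $x\in X$. Then: (i) If $\phi$ is a convex function and $F$ is a convex set-valued mapping, then $\mu$ is convex. (ii) If $\phi$ is an int-nearly convex function and $F$ is an int-nearly convex set-valued mapping satisfying $$\operatorname{int}(\operatorname{epi}\phi)\cap\operatorname{int}\big((\operatorname{gph}F)\times\mathbb R\big)\neq\emptyset,$$ then $\mu$ is int-nearly convex.
   Context: LCTV space means real locally convex Hausdorff topological vector space. $\overline{\mathbb R}=\mathbb R\cup\{-\infty\}\cup\{\infty\}$ and $\inf\emptyset=\infty$. For $f\colon X\to\overline{\mathbb R}$, $\operatorname{epi}f=\{(x,\lambda)\in X\times\mathbb R\mid f(x)\le\lambda\}$; $f$ is convex if $\operatorname{epi}f$ is convex. For $F\colon X\rightrightarrows Y$, $\operatorname{gph}F=\{(x,y)\in X\times Y\mid y\in F(x)\}$; $F$ is convex if $\operatorname{gph}F$ is convex. A set $\Omega$ is int-nearly convex if there is a convex set $C$ with $\operatorname{int}C\ne\emptyset$ and $C\subset\Omega\subset\overline C$. A function (resp. set-valued mapping) is int-nearly convex if its epigraph (resp. graph) is an int-nearly convex set. In the displayed condition the set $(\operatorname{gph}F)\times\mathbb R$ is regarded as a subset of $X\times Y\times\mathbb R$. *)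

theory Defs
  imports "HOL-Analysis.Analysis"
begin

text \<open>
  Real locally convex Hausdorff topological vector spaces. Continuity of addition and negation
  comes from \<^class>\<open>topological_ab_group_add\<close>, the Hausdorff property from \<^class>\<open>t2_space\<close>.
  The class specification cannot mention \<^const>\<open>convex\<close> or product topologies on the class
  type, so joint continuity of scaling is stated with filters and convexity is unfolded;
  the two lemmas after the class give the usual forms.
\<close>

class lctv_space = real_vector + topological_ab_group_add + t2_space +
  assumes tendsto_scaleR_Pair:
      "LIM p (nhds c \<times>\<^sub>F nhds a). fst p *\<^sub>R snd p :> nhds (c *\<^sub>R a)"
    and locally_convex_raw:
      "open U \<Longrightarrow> 0 \<in> U \<Longrightarrow>
        \<exists>V. open V \<and> 0 \<in> V \<and> V \<subseteq> U \<and>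
          (\<forall>x\<in>V. \<forall>y\<in>V. \<forall>u\<ge>0. \<forall>v\<ge>0. u + v = 1 \<longrightarrow> u *\<^sub>R x + v *\<^sub>R y \<in> V)"

lemma continuous_on_scaleR_lctv:
  "continuous_on UNIV (\<lambda>p :: real \<times> 'a::lctv_space. fst p *\<^sub>R snd p)"
  by (auto simp: continuous_on_def nhds_prod intro!: tendsto_scaleR_Pair
      intro: filterlim_mono[OF _ order_refl at_le] tendsto_mono[OF at_within_le_nhds])

lemma locally_convex:
  fixes U :: "'a::lctv_space set"
  assumes "open U" "0 \<in> U"
  obtains V where "open V" "convex V" "0 \<in> V" "V \<subseteq> U"
  using locally_convex_raw[OF assms] unfolding convex_def by blast

instance real_normed_vector \<subseteq> lctv_space
proof
  fix c :: real and a :: 'a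
  show "LIM p (nhds c \<times>\<^sub>F nhds a). fst p *\<^sub>R snd p :> nhds (c *\<^sub>R a)"
    by (intro tendsto_scaleR filterlim_fst filterlim_snd)
next
  fix U :: "'a set"
  assume "open U" "0 \<in> U"
  then obtain e where e: "e > 0" "ball 0 e \<subseteq> U"
    using openE by blast
  have "convex (ball (0::'a) e)"
    by (rule convex_ball)
  with e show "\<exists>V. open V \<and> 0 \<in> V \<and> V \<subseteq> U \<and>
      (\<forall>x\<in>V. \<forall>y\<in>V. \<forall>u\<ge>0. \<forall>v\<ge>0. u + v = 1 \<longrightarrow> u *\<^sub>R x + v *\<^sub>R y \<in> V)"
    unfolding convex_def by (intro exI[of _ "ball 0 e"]) simp
qed

text \<open>
  The library's \<open>epigraph\<close> is only for real-valued functions; the functions here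
  take values in the extended reals, while \<open>\<lambda>\<close> remains a real number.
\<close>

definition epi :: "('a \<Rightarrow> ereal) \<Rightarrow> ('a \<times> real) set" where
  "epi f = {(x, l). f x \<le> ereal l}"

definition gph :: "('a \<Rightarrow> 'b set) \<Rightarrow> ('a \<times> 'b) set" where
  "gph F = {(x, y). y \<in> F x}"

definition convex_fun :: "('a::real_vector \<Rightarrow> ereal) \<Rightarrow> bool" where
  "convex_fun f \<longleftrightarrow> convex (epi f)"

definition convex_map :: "('a::real_vector \<Rightarrow> 'b::real_vector set) \<Rightarrow> bool" where
  "convex_map F \<longleftrightarrow> convex (gph F)"

definition int_nearly_convex :: "'a::{real_vector, topological_space} set \<Rightarrow> bool" where
  "int_nearly_convex \<Omega> \<longleftrightarrow>
     (\<exists>C. convex C \<and> interior C \<noteq> {} \<and> C \<subseteq> \<Omega> \<and> \<Omega> \<subseteq> closure C)"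

definition int_nearly_convex_fun ::
    "('a::{real_vector, topological_space} \<Rightarrow> ereal) \<Rightarrow> bool" where
  "int_nearly_convex_fun f \<longleftrightarrow> int_nearly_convex (epi f)"

definition int_nearly_convex_map ::
    "('a::{real_vector, topological_space} \<Rightarrow> 'b::{real_vector, topological_space} set) \<Rightarrow> bool" where
  "int_nearly_convex_map F \<longleftrightarrow> int_nearly_convex (gph F)"

text \<open>
  The infimum is taken in the complete lattice \<^typ>\<open>ereal\<close>, so it is \<open>\<infinity>\<close> when \<open>F x\<close> is empty.
\<close>

definition optimal_value :: "('a \<times> 'b \<Rightarrow> ereal) \<Rightarrow> ('a \<Rightarrow> 'b set) \<Rightarrow> 'a \<Rightarrow> ereal" where
  "optimal_value \<phi> F x = Inf {\<phi> (x, y) | y. y \<in> F x}"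

end

theory Submission
  imports Defs
begin

text \<open>
  Both parts rest on one description of the epigraph of the marginal function. Let \<open>S\<close> be the
  projection of \<open>epi \<phi> \<inter> (gph F \<times> \<real>)\<close> along the variable \<open>y\<close>. A point \<open>(x, l)\<close> lies in the
  epigraph exactly when \<open>(x, l + e) \<in> S\<close> for every \<open>e > 0\<close>; the infimum need not be attained, so
  the slack \<open>e\<close> cannot be dropped, but it shows that the epigraph lies between \<open>S\<close> and its closure.

  For convex data \<open>S\<close> is convex, and the condition "for every \<open>e > 0\<close>" passes convexity on to the
  epigraph.

  For int-nearly convex data the point is that int-near convexity survives the operations which
  build the epigraph: the product with the whole line, the intersection of two sets whose interiors
  meet, the image under an open continuous linear map, and the passage to a set between \<open>S\<close> and its
  closure. Only the intersection needs an argument. It uses the fact that in a topological vector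
  space the segment from an interior point of a convex set to a point of its closure stays in the
  interior, except possibly at its end. Consequently a convex set with nonempty interior has the
  same interior as its closure, so the interiors of the two convex cores have a common point, and
  every common point of the two closures is reached along the segment from it.
\<close>

section \<open>Topological vector spaces and their products\<close>

text \<open>
  The intermediate sets live in products such as \<open>(X \<times> Y) \<times> \<real>\<close>. Isolating joint continuity of
  the operations in a class of its own gives one notion that covers \<open>X\<close>, \<open>Y\<close>, \<open>\<real>\<close> and, by the
  instance below, all products of these.
\<close>

class real_tvs = real_vector + topological_ab_group_add +
  assumes tendsto_scaleR_nhds:
    "LIM p (nhds c \<times>\<^sub>F nhds a). fst p *\<^sub>R snd p :> nhds (c *\<^sub>R a)"

instance lctv_space \<subseteq> real_tvs
  by standard (rule tendsto_scaleR_Pair)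

lemma tendsto_scaleR_tvs:
  fixes g :: "'b \<Rightarrow> 'a::real_tvs"
  assumes "(f \<longlongrightarrow> c) \<F>" "(g \<longlongrightarrow> a) \<F>"
  shows "((\<lambda>x. f x *\<^sub>R g x) \<longlongrightarrow> c *\<^sub>R a) \<F>"
  using filterlim_compose[OF tendsto_scaleR_nhds filterlim_Pair[OF assms]] by simp

lemma continuous_on_scaleR_tvs:
  fixes g :: "'b::topological_space \<Rightarrow> 'a::real_tvs"
  assumes "continuous_on A f" "continuous_on A g"
  shows "continuous_on A (\<lambda>x. f x *\<^sub>R g x)"
  using assms unfolding continuous_on_def by (auto intro: tendsto_scaleR_tvs)

instance prod :: (topological_monoid_add, topological_monoid_add) topological_monoid_add
proof
  fix a b :: "'a \<times> 'b"
  show "LIM p (nhds a \<times>\<^sub>F nhds b). fst p + snd p :> nhds (a + b)"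
    unfolding plus_prod_def
    by (intro tendsto_Pair tendsto_add tendsto_fst tendsto_snd filterlim_fst filterlim_snd)
qed

instance prod ::
  (topological_comm_monoid_add, topological_comm_monoid_add) topological_comm_monoid_add ..

instance prod :: (topological_group_add, topological_group_add) topological_group_add
proof
  fix a :: "'a \<times> 'b"
  show "(uminus \<longlongrightarrow> - a) (nhds a)"
    unfolding uminus_prod_def
    by (intro tendsto_Pair tendsto_minus tendsto_fst tendsto_snd filterlim_ident)
qed

instance prod :: (topological_ab_group_add, topological_ab_group_add) topological_ab_group_add ..

instance prod :: (real_tvs, real_tvs) real_tvs
proof
  fix a :: "'a \<times> 'b" and c :: real
  show "LIM p (nhds c \<times>\<^sub>F nhds a). fst p *\<^sub>R snd p :> nhds (c *\<^sub>R a)"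
    unfolding scaleR_prod_def
    by (intro tendsto_Pair tendsto_scaleR_tvs tendsto_fst tendsto_snd
        filterlim_fst filterlim_snd)
qed

section \<open>Interior and closure of convex sets\<close>

lemma open_affine_preimage_tvs:
  fixes U :: "'a::real_tvs set"
  assumes "open U"
  shows "open {w. r *\<^sub>R (w - p) + q \<in> U}"
proof -
  have "continuous_on UNIV (\<lambda>w. r *\<^sub>R (w - p) + q)"
    by (intro continuous_intros continuous_on_scaleR_tvs)
  then have "open ((\<lambda>w. r *\<^sub>R (w - p) + q) -` U)"
    using assms by (rule open_vimage[rotated])
  then show ?thesis
    by (simp add: vimage_def)
qed

text \<open>
  Fix the point \<open>x\<close> of the segment. Moving the interior end point \<open>a\<close> a little and keeping \<open>x\<close>
  fixed moves the other end point over a whole neighbourhood of \<open>b\<close>, which contains some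
  \<open>c \<in> C\<close>. So \<open>x\<close> also lies on a segment from an interior point to a point of \<open>C\<close> itself, and the
  shrunk copy of the interior along that segment is a neighbourhood of \<open>x\<close> inside \<open>C\<close>.
\<close>

lemma interior_closure_segment:
  fixes C :: "'a::real_tvs set"
  assumes C: "convex C" and a: "a \<in> interior C" and b: "b \<in> closure C"
    and t: "0 < t" "t \<le> 1"
  shows "t *\<^sub>R a + (1 - t) *\<^sub>R b \<in> interior C"
proof (cases "t = 1")
  case False
  with t have t1: "t < 1" by simp
  define x where "x = t *\<^sub>R a + (1 - t) *\<^sub>R b"
  \<comment> \<open>\<open>W\<close> and \<open>U\<close> come from solving \<open>x = t a' + (1 - t) w\<close> and \<open>w = t a' + (1 - t) c\<close> for \<open>a'\<close>.\<close>
  define W where "W = {w. (- ((1 - t) / t)) *\<^sub>R (w - b) + a \<in> interior C}"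
  have "open W"
    unfolding W_def by (rule open_affine_preimage_tvs) simp
  moreover have "b \<in> W"
    using a by (simp add: W_def)
  ultimately obtain c where c: "c \<in> C" "c \<in> W"
    using b by (auto simp: closure_iff_nhds_not_empty)
  define U where "U = {w. (1 / t) *\<^sub>R (w - (1 - t) *\<^sub>R c) + 0 \<in> interior C}"
  have "open U"
    unfolding U_def by (rule open_affine_preimage_tvs) simp
  moreover have "U \<subseteq> C"
  proof
    fix w assume "w \<in> U"
    then have "(1 / t) *\<^sub>R (w - (1 - t) *\<^sub>R c) \<in> C"
      using interior_subset by (auto simp: U_def)
    then have "t *\<^sub>R ((1 / t) *\<^sub>R (w - (1 - t) *\<^sub>R c)) + (1 - t) *\<^sub>R c \<in> C"
      using C c t t1 by (intro convexD) auto
    then show "w \<in> C"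
      using t by simp
  qed
  moreover have "x \<in> U"
  proof -
    have "(1 / t) *\<^sub>R (x - (1 - t) *\<^sub>R c) = (- ((1 - t) / t)) *\<^sub>R (c - b) + a"
      using t by (simp add: x_def algebra_simps diff_divide_distrib add_divide_distrib)
    then show ?thesis
      using c by (simp add: U_def W_def)
  qed
  ultimately show ?thesis
    unfolding x_def using interiorI by blast
qed (use a in simp)

lemma convex_interior_tvs:
  fixes C :: "'a::real_tvs set"
  assumes "convex C"
  shows "convex (interior C)"
proof (rule convexI)
  fix x y :: 'a and u v :: real
  assume xy: "x \<in> interior C" "y \<in> interior C" and uv: "0 \<le> u" "0 \<le> v" "u + v = 1"
  have v: "v = 1 - u" using uv by simp
  show "u *\<^sub>R x + v *\<^sub>R y \<in> interior C"
  proof (cases "u = 0")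
    case False
    have "y \<in> closure C"
      using xy interior_subset closure_subset by blast
    then show ?thesis
      unfolding v using xy uv False assms by (intro interior_closure_segment) auto
  qed (use xy v in simp)
qed

lemma tendsto_segment_tvs:
  fixes a b :: "'a::real_tvs"
  shows "((\<lambda>t. t *\<^sub>R a + (1 - t) *\<^sub>R b) \<longlongrightarrow> b) (at_right 0)"
proof -
  have "((\<lambda>t. t *\<^sub>R a + (1 - t) *\<^sub>R b) \<longlongrightarrow> 0 *\<^sub>R a + (1 - 0) *\<^sub>R b) (at_right 0)"
    by (intro tendsto_add tendsto_scaleR_tvs tendsto_diff tendsto_const tendsto_ident_at)
  then show ?thesis by simp
qed

text \<open>
  An interior point \<open>x\<close> of the closure can be pushed slightly away from an interior point \<open>a\<close> of
  \<open>C\<close> without leaving the closure; then \<open>x\<close> lies strictly inside the segment from \<open>a\<close> to the pushed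
  point.
\<close>

lemma interior_closure_convex_tvs:
  fixes C :: "'a::real_tvs set"
  assumes C: "convex C" and ne: "interior C \<noteq> {}"
  shows "interior (closure C) = interior C"
proof
  show "interior C \<subseteq> interior (closure C)"
    by (simp add: closure_subset interior_mono)
  show "interior (closure C) \<subseteq> interior C"
  proof
    fix x assume x: "x \<in> interior (closure C)"
    obtain a where a: "a \<in> interior C" using ne by blast
    \<comment> \<open>The segment from \<open>x\<close> towards the reflected point \<open>2x - a\<close> points away from \<open>a\<close>.\<close>
    have "\<forall>\<^sub>F s in at_right 0. s *\<^sub>R (2 *\<^sub>R x - a) + (1 - s) *\<^sub>R x \<in> interior (closure C)"
      by (rule topological_tendstoD[OF tendsto_segment_tvs]) (use x in auto)
    moreover have "\<forall>\<^sub>F s in at_right (0::real). 0 < s"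
      by (rule eventually_at_right_less)
    ultimately have "\<forall>\<^sub>F s in at_right 0.
        s *\<^sub>R (2 *\<^sub>R x - a) + (1 - s) *\<^sub>R x \<in> interior (closure C) \<and> 0 < s"
      by (rule eventually_conj)
    then obtain s where s: "0 < s" and
      b: "s *\<^sub>R (2 *\<^sub>R x - a) + (1 - s) *\<^sub>R x \<in> interior (closure C)" (is "?b \<in> _")
      using eventually_happens' trivial_limit_at_right_real by blast
    define t where "t = s / (1 + s)"
    have t: "0 < t" "t \<le> 1" and 1: "1 - t = 1 / (1 + s)"
      using s by (auto simp: t_def field_simps)
    have "?b \<in> closure C"
      using b interior_subset by blast
    then have "t *\<^sub>R a + (1 - t) *\<^sub>R ?b \<in> interior C"
      by (rule interior_closure_segment[OF C a _ t])
    moreover have "t *\<^sub>R a + (1 - t) *\<^sub>R ?b = x"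
    proof -
      have b': "?b = (1 + s) *\<^sub>R x - s *\<^sub>R a"
        by (simp add: algebra_simps scaleR_2)
      show ?thesis
        unfolding b' 1 using s by (simp add: t_def scaleR_diff_right)
    qed
    ultimately show "x \<in> interior C" by simp
  qed
qed

text \<open>
  For arbitrary sets the closure of an intersection can be much smaller than the intersection of
  the closures. A common interior point prevents this: from it a segment leads to any \<open>b\<close> in both
  closures, and \<open>b\<close> is the limit of points of the segment that are interior to both sets.
\<close>

lemma closure_Int_closure_convex_subset:
  fixes C D :: "'a::real_tvs set"
  assumes C: "convex C" and D: "convex D" and a: "a \<in> interior C" "a \<in> interior D"
  shows "closure C \<inter> closure D \<subseteq> closure (interior C \<inter> interior D)"
proof
  fix b assume b: "b \<in> closure C \<inter> closure D"
  have "\<forall>\<^sub>F t in at_right (0::real). 0 < t \<and> t < 1"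
    using eventually_at_right_real[of 0 1] by simp
  then have "\<forall>\<^sub>F t in at_right 0.
      t *\<^sub>R a + (1 - t) *\<^sub>R b \<in> closure (interior C \<inter> interior D)"
  proof eventually_elim
    case (elim t)
    then have "t *\<^sub>R a + (1 - t) *\<^sub>R b \<in> interior C \<inter> interior D"
      using b by (intro IntI interior_closure_segment C D a) auto
    then show ?case by (rule subsetD[OF closure_subset])
  qed
  then show "b \<in> closure (interior C \<inter> interior D)"
    using Lim_in_closed_set[OF closed_closure _ trivial_limit_at_right_real
        tendsto_segment_tvs[of a b]] by simp
qed

section \<open>Operations that preserve int-near convexity\<close>

text \<open>
  Since \<open>\<Omega>\<close> lies between a convex core and its closure, and both have the same interior,
  the assumption on the interiors of the sets is one on the interiors of the cores. The open
  intersection of the latter is a convex core of the intersection.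
\<close>

lemma int_nearly_convex_Int:
  fixes \<Omega> \<Theta> :: "'a::real_tvs set"
  assumes "int_nearly_convex \<Omega>" "int_nearly_convex \<Theta>" and ne: "interior \<Omega> \<inter> interior \<Theta> \<noteq> {}"
  shows "int_nearly_convex (\<Omega> \<inter> \<Theta>)"
proof -
  obtain C where C: "convex C" "interior C \<noteq> {}" "C \<subseteq> \<Omega>" "\<Omega> \<subseteq> closure C"
    using assms(1) unfolding int_nearly_convex_def by blast
  obtain D where D: "convex D" "interior D \<noteq> {}" "D \<subseteq> \<Theta>" "\<Theta> \<subseteq> closure D"
    using assms(2) unfolding int_nearly_convex_def by blast
  have "interior \<Omega> \<subseteq> interior C" "interior \<Theta> \<subseteq> interior D"
    using C D interior_mono interior_closure_convex_tvs by metis+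
  then obtain a where a: "a \<in> interior C" "a \<in> interior D"
    using ne by blast
  have "convex (interior C \<inter> interior D)"
    by (intro convex_Int convex_interior_tvs C D)
  moreover have "interior (interior C \<inter> interior D) \<noteq> {}"
    using a by (auto simp: interior_open)
  moreover have "interior C \<inter> interior D \<subseteq> \<Omega> \<inter> \<Theta>"
    using C D interior_subset by blast
  moreover have "\<Omega> \<inter> \<Theta> \<subseteq> closure (interior C \<inter> interior D)"
    using closure_Int_closure_convex_subset[OF C(1) D(1) a] C D by blast
  ultimately show ?thesis
    unfolding int_nearly_convex_def by blast
qed

lemma int_nearly_convex_Times_UNIV:
  assumes "int_nearly_convex \<Omega>"
  shows "int_nearly_convex (\<Omega> \<times> UNIV)"
proof -
  obtain C where "convex C" "interior C \<noteq> {}" "C \<subseteq> \<Omega>" "\<Omega> \<subseteq> closure C"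
    using assms unfolding int_nearly_convex_def by blast
  then show ?thesis
    unfolding int_nearly_convex_def
    by (intro exI[of _ "C \<times> UNIV"])
      (auto simp: convex_Times interior_Times closure_Times)
qed

text \<open>
  Openness of the map keeps the interior of the convex core nonempty, continuity keeps the image
  inside the closure of the new core.
\<close>

lemma int_nearly_convex_linear_image:
  assumes "int_nearly_convex \<Omega>" and f: "linear f" "continuous_on UNIV f"
    and opn: "\<And>U. open U \<Longrightarrow> open (f ` U)"
  shows "int_nearly_convex (f ` \<Omega>)"
proof -
  obtain C where C: "convex C" "interior C \<noteq> {}" "C \<subseteq> \<Omega>" "\<Omega> \<subseteq> closure C"
    using assms(1) unfolding int_nearly_convex_def by blast
  have "f ` interior C \<subseteq> interior (f ` C)"
    by (intro interior_maximal opn image_mono interior_subset) simp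
  then have "interior (f ` C) \<noteq> {}"
    using C by blast
  moreover have "f ` closure C \<subseteq> closure (f ` C)"
    by (rule image_closure_subset[OF continuous_on_subset[OF f(2)] closed_closure closure_subset]) simp
  ultimately show ?thesis
    unfolding int_nearly_convex_def using C convex_linear_image[OF f(1) C(1)]
    by (intro exI[of _ "f ` C"]) blast
qed

lemma int_nearly_convex_sandwich:
  assumes "int_nearly_convex \<Omega>" "\<Omega> \<subseteq> \<Theta>" "\<Theta> \<subseteq> closure \<Omega>"
  shows "int_nearly_convex \<Theta>"
proof -
  obtain C where C: "convex C" "interior C \<noteq> {}" "C \<subseteq> \<Omega>" "\<Omega> \<subseteq> closure C"
    using assms(1) unfolding int_nearly_convex_def by blast
  have "closure \<Omega> \<subseteq> closure C"
    using C by (simp add: closure_minimal)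
  with C assms(2,3) have "C \<subseteq> \<Theta>" "\<Theta> \<subseteq> closure C"
    by blast+
  with C show ?thesis
    unfolding int_nearly_convex_def by (intro exI[of _ C] conjI)
qed

section \<open>The epigraph of the marginal function\<close>

definition forget_y :: "('x \<times> 'y) \<times> real \<Rightarrow> 'x \<times> real" where
  "forget_y p = (fst (fst p), snd p)"

lemma linear_forget_y: "linear forget_y"
  by (rule linearI) (simp_all add: forget_y_def)

lemma continuous_on_forget_y: "continuous_on UNIV forget_y"
  unfolding forget_y_def by (intro continuous_intros)

lemma open_forget_y_image:
  fixes U :: "(('x::topological_space \<times> 'y::topological_space) \<times> real) set"
  assumes "open U"
  shows "open (forget_y ` U)"
proof -
  \<comment> \<open>The image is the union over \<open>y\<close> of the slices of \<open>U\<close>, and each slice is open.\<close>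
  have "forget_y ` U = (\<Union>y. (\<lambda>p. ((fst p, y), snd p)) -` U)"
    by (force simp: forget_y_def)
  moreover have "open ((\<lambda>p. ((fst p, y), snd p)) -` U)" for y
    by (rule open_vimage[OF assms]) (intro continuous_intros)
  ultimately show ?thesis by auto
qed

lemma mem_forget_y_image_iff:
  "(x, l) \<in> forget_y ` (epi \<phi> \<inter> gph F \<times> UNIV) \<longleftrightarrow> (\<exists>y\<in>F x. \<phi> (x, y) \<le> ereal l)"
proof -
  have "(x, l) \<in> forget_y ` (epi \<phi> \<inter> gph F \<times> UNIV) \<longleftrightarrow>
      (\<exists>y. ((x, y), l) \<in> epi \<phi> \<inter> gph F \<times> UNIV)"
    by (auto simp: forget_y_def image_iff Bex_def)
  then show ?thesis
    by (auto simp: epi_def gph_def)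
qed

text \<open>
  The slack \<open>e\<close> also covers the case where the infimum is \<open>-\<infinity>\<close>. An empty \<open>F x\<close> satisfies
  neither side, since the infimum is then \<open>\<infinity>\<close> while \<open>l\<close> is real.
\<close>

lemma mem_epi_optimal_value_iff:
  "(x, l) \<in> epi (optimal_value \<phi> F) \<longleftrightarrow>
     (\<forall>e>0. (x, l + e) \<in> forget_y ` (epi \<phi> \<inter> gph F \<times> UNIV))"
proof
  assume "(x, l) \<in> epi (optimal_value \<phi> F)"
  then have le: "optimal_value \<phi> F x \<le> ereal l"
    by (simp add: epi_def)
  show "\<forall>e>0. (x, l + e) \<in> forget_y ` (epi \<phi> \<inter> gph F \<times> UNIV)"
  proof (intro allI impI)
    fix e :: real assume "e > 0"
    then have "optimal_value \<phi> F x < ereal (l + e)"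
      using le by (auto intro: le_less_trans)
    then show "(x, l + e) \<in> forget_y ` (epi \<phi> \<inter> gph F \<times> UNIV)"
      unfolding mem_forget_y_image_iff optimal_value_def Inf_less_iff
      by (auto intro: less_imp_le)
  qed
next
  assume slack: "\<forall>e>0. (x, l + e) \<in> forget_y ` (epi \<phi> \<inter> gph F \<times> UNIV)"
  have "optimal_value \<phi> F x \<le> ereal l + ereal e" if e: "e > 0" for e
  proof -
    obtain y where "y \<in> F x" "\<phi> (x, y) \<le> ereal (l + e)"
      using slack e unfolding mem_forget_y_image_iff by blast
    then show ?thesis
      unfolding optimal_value_def by (auto intro: Inf_lower2)
  qed
  then have "optimal_value \<phi> F x \<le> ereal l"
    by (rule ereal_le_epsilon2)
  then show "(x, l) \<in> epi (optimal_value \<phi> F)"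
    by (simp add: epi_def)
qed

lemma forget_y_image_subset_epi:
  "forget_y ` (epi \<phi> \<inter> gph F \<times> UNIV) \<subseteq> epi (optimal_value \<phi> F)"
proof (rule subrelI)
  fix x l assume "(x, l) \<in> forget_y ` (epi \<phi> \<inter> gph F \<times> UNIV)"
  then obtain y where y: "y \<in> F x" "\<phi> (x, y) \<le> ereal l"
    unfolding mem_forget_y_image_iff by blast
  then have "optimal_value \<phi> F x \<le> ereal l"
    unfolding optimal_value_def by (auto intro: Inf_lower2)
  then show "(x, l) \<in> epi (optimal_value \<phi> F)"
    by (simp add: epi_def)
qed

lemma epi_subset_closure_forget_y_image:
  fixes \<phi> :: "'x::topological_space \<times> 'y \<Rightarrow> ereal"
  shows "epi (optimal_value \<phi> F) \<subseteq> closure (forget_y ` (epi \<phi> \<inter> gph F \<times> UNIV))"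
    (is "_ \<subseteq> closure ?S")
proof (rule subrelI)
  fix x l assume "(x, l) \<in> epi (optimal_value \<phi> F)"
  then have S: "(x, l + e) \<in> closure ?S" if "e > 0" for e
    using that closure_subset unfolding mem_epi_optimal_value_iff by blast
  have "\<forall>\<^sub>F e in at_right 0. (x, l + e) \<in> closure ?S"
    using eventually_at_right_less by (rule eventually_mono) (rule S)
  moreover have "((\<lambda>e. (x, l + e)) \<longlongrightarrow> (x, l + 0)) (at_right 0)"
    by (intro tendsto_intros)
  ultimately have "(x, l + 0) \<in> closure ?S"
    by (intro Lim_in_closed_set[OF closed_closure _ trivial_limit_at_right_real])
  then show "(x, l) \<in> closure ?S" by simp
qed

text \<open>
  Both points of the epigraph can be given the same slack \<open>e\<close>, and the convex combination of their
  heights then has slack \<open>e\<close> again, because the weights sum to 1.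
\<close>

lemma convex_epi_optimal_value:
  assumes "convex (forget_y ` (epi \<phi> \<inter> gph F \<times> UNIV))" (is "convex ?S")
  shows "convex (epi (optimal_value \<phi> F))"
proof (rule convexI)
  fix p q and u v :: real
  assume pq: "p \<in> epi (optimal_value \<phi> F)" "q \<in> epi (optimal_value \<phi> F)"
    and uv: "0 \<le> u" "0 \<le> v" "u + v = 1"
  obtain x l x' l' where p: "p = (x, l)" and q: "q = (x', l')"
    by (metis surj_pair)
  have "(u *\<^sub>R x + v *\<^sub>R x', u * l + v * l' + e) \<in> ?S" if "e > 0" for e
  proof -
    have "(x, l + e) \<in> ?S" "(x', l' + e) \<in> ?S"
      using pq that unfolding p q mem_epi_optimal_value_iff by auto
    then have "u *\<^sub>R (x, l + e) + v *\<^sub>R (x', l' + e) \<in> ?S"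
      using uv by (intro convexD[OF assms])
    moreover have "u * (l + e) + v * (l' + e) = u * l + v * l' + e"
    proof -
      have "u * (l + e) + v * (l' + e) = u * l + v * l' + (u + v) * e"
        by (simp add: algebra_simps)
      then show ?thesis using uv by simp
    qed
    ultimately show ?thesis by simp
  qed
  then show "u *\<^sub>R p + v *\<^sub>R q \<in> epi (optimal_value \<phi> F)"
    unfolding p q by (simp add: mem_epi_optimal_value_iff)
qed

theorem theorem4p4:
  fixes \<phi> :: "'x::lctv_space \<times> 'y::lctv_space \<Rightarrow> ereal"
    and F :: "'x \<Rightarrow> 'y set"
  shows "(convex_fun \<phi> \<and> convex_map F \<longrightarrow> convex_fun (optimal_value \<phi> F)) \<and>
    (int_nearly_convex_fun \<phi> \<and> int_nearly_convex_map F \<and>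
       interior (epi \<phi>) \<inter> interior (gph F \<times> (UNIV :: real set)) \<noteq> {} \<longrightarrow>
     int_nearly_convex_fun (optimal_value \<phi> F))"
proof (intro conjI impI; elim conjE)
  assume "convex_fun \<phi>" "convex_map F"
  then have "convex (epi \<phi> \<inter> gph F \<times> UNIV)"
    unfolding convex_fun_def convex_map_def by (intro convex_Int convex_Times convex_UNIV)
  then show "convex_fun (optimal_value \<phi> F)"
    unfolding convex_fun_def
    by (intro convex_epi_optimal_value convex_linear_image linear_forget_y)
next
  assume "int_nearly_convex_fun \<phi>" "int_nearly_convex_map F"
    and "interior (epi \<phi>) \<inter> interior (gph F \<times> (UNIV :: real set)) \<noteq> {}"
  then have "int_nearly_convex (epi \<phi> \<inter> gph F \<times> UNIV)"
    unfolding int_nearly_convex_fun_def int_nearly_convex_map_def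
    by (intro int_nearly_convex_Int int_nearly_convex_Times_UNIV)
  then have "int_nearly_convex (forget_y ` (epi \<phi> \<inter> gph F \<times> UNIV))"
    by (intro int_nearly_convex_linear_image linear_forget_y continuous_on_forget_y
        open_forget_y_image)
  then show "int_nearly_convex_fun (optimal_value \<phi> F)"
    unfolding int_nearly_convex_fun_def
    by (rule int_nearly_convex_sandwich[OF _ forget_y_image_subset_epi
          epi_subset_closure_forget_y_image])
qed

end
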